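(* Let $p$ be an odd prime and $v$ an $m$-dimensional integral vector each of whose entries is nonzero modulo $p$. For each $k\in\{1,2,\ldots,p-1\}$, let $\mathcal{R}_k$ be the set of all perfect $p$-representatives of $kv$. Then $v$ can generate a primitive matrix if and only if $\sum_{k=1}^{p-1}|\mathcal{R}_k|=m$.
   Context: $e$ is the all-one vector. For integral vectors $v,w$, $w$ is a perfect $p$-representative of $v$ if $w\equiv v\pmod p$, $w^{\mathrm T}e=p$ and $w^{\mathrm T}w=p^2$. An orthogonal matrix $Q$ is regular if $Qe=e$; the level of a rational matrix $Q$ is the least positive integer $k$ with $kQ$ integral. A primitive matrix is a regular rational orthogonal matrix $Q$ of level $p$ such that $pQ$ has rank $1$ over $\mathbb{F}_p=\mathbb{Z}/p\mathbb{Z}$. An integral $m$-dimensional vector $v$ generates an $m\times m$ primitive matrix $Q$ if each column of $pQ$ is a multiple of $v$ over $\mathbb{F}_p$. *)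

theory Defs
  imports "HOL-Analysis.Analysis" "HOL-Number_Theory.Cong"
begin

definition vec_cong :: "int ^ 'm \<Rightarrow> int ^ 'm \<Rightarrow> nat \<Rightarrow> bool" where
  "vec_cong x y p \<longleftrightarrow> (\<forall>i. [x $ i = y $ i] (mod int p))"

text \<open>The all-one vector is the constant \<open>1\<close> of the vector type.\<close>

definition perfect_representative :: "nat \<Rightarrow> int ^ 'm \<Rightarrow> int ^ 'm \<Rightarrow> bool" where
  "perfect_representative p v w \<longleftrightarrow>
     vec_cong w v p \<and> scalar_product w 1 = int p \<and> scalar_product w w = (int p)\<^sup>2"

definition regular_orthogonal :: "rat ^ 'm ^ 'm \<Rightarrow> bool" where
  "regular_orthogonal Q \<longleftrightarrow> orthogonal_matrix Q \<and> Q *v 1 = 1"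

definition integral_multiple :: "nat \<Rightarrow> rat ^ 'm ^ 'n \<Rightarrow> bool" where
  "integral_multiple k Q \<longleftrightarrow> (\<forall>i j. of_nat k * Q $ i $ j \<in> \<int>)"

definition level :: "rat ^ 'm ^ 'n \<Rightarrow> nat" where
  "level Q = (LEAST k. 0 < k \<and> integral_multiple k Q)"

text \<open>The matrix \<open>kQ\<close> with its entries read as integers; the floor is exact whenever
  \<open>kQ\<close> is integral, in particular for \<open>k = level Q\<close>.\<close>

definition int_multiple :: "nat \<Rightarrow> rat ^ 'm ^ 'n \<Rightarrow> int ^ 'm ^ 'n" where
  "int_multiple k Q = (\<chi> i j. \<lfloor>of_nat k * Q $ i $ j\<rfloor>)"

lemma of_int_int_multiple:
  "integral_multiple k Q \<Longrightarrow> of_int (int_multiple k Q $ i $ j) = of_nat k * Q $ i $ j"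
  by (simp add: integral_multiple_def int_multiple_def of_int_floor)

text \<open>Elements of \<open>\<int>/p\<int>\<close> are represented by integers up to congruence. The columns with
  indices in \<open>J\<close> are linearly independent over \<open>\<int>/p\<int>\<close> as a family, so two congruent columns
  with different indices are dependent. The rank is the column rank.\<close>

definition indep_columns_mod :: "nat \<Rightarrow> int ^ 'n ^ 'm \<Rightarrow> 'n set \<Rightarrow> bool" where
  "indep_columns_mod p A J \<longleftrightarrow>
     (\<forall>c :: 'n \<Rightarrow> int. vec_cong (\<Sum>j\<in>J. c j *s column j A) 0 p \<longrightarrow> (\<forall>j\<in>J. [c j = 0] (mod int p)))"

definition rank_mod :: "nat \<Rightarrow> int ^ 'n ^ 'm \<Rightarrow> nat" where
  "rank_mod p A = Max {card J | J. indep_columns_mod p A J}"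

definition primitive_matrix :: "nat \<Rightarrow> rat ^ 'm ^ 'm \<Rightarrow> bool" where
  "primitive_matrix p Q \<longleftrightarrow>
     regular_orthogonal Q \<and> level Q = p \<and> rank_mod p (int_multiple p Q) = 1"

definition generates :: "nat \<Rightarrow> int ^ 'm \<Rightarrow> rat ^ 'm ^ 'm \<Rightarrow> bool" where
  "generates p v Q \<longleftrightarrow>
     primitive_matrix p Q \<and> (\<forall>j. \<exists>c. vec_cong (column j (int_multiple p Q)) (c *s v) p)"

end

theory Submission
  imports Defs
begin

text \<open>
  Let \<open>R\<close> be the union of the sets \<open>R\<^sub>k\<close>. If \<open>w \<equiv> kv\<close> and \<open>w' \<equiv> lv\<close> are in \<open>R\<close>, then
  \<open>lw - kw' = pz\<close> for an integral \<open>z\<close>; comparing squared lengths gives \<open>p\<^sup>2 | 2kl(w \<bullet> w')\<close>, hence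
  \<open>p\<^sup>2 | w \<bullet> w'\<close> because \<open>p\<close> is odd. Both vectors have length \<open>p\<close> and entry sum \<open>p\<close>, so
  Cauchy-Schwarz leaves only \<open>w = w'\<close> or \<open>w \<bullet> w' = 0\<close>. Thus \<open>R\<close> is an orthogonal system, and
  \<open>m\<close> elements of \<open>R\<close> are, after division by \<open>p\<close>, the columns of a primitive matrix. Conversely, no
  column of a matrix generated by \<open>v\<close> vanishes mod \<open>p\<close>: such a column would be \<open>p\<close> times a unit
  vector, which forces a zero entry into every other column. Hence all \<open>m\<close> columns lie in \<open>R\<close>, and
  \<open>R\<close> contains nothing else, since it is orthogonal.
\<close>

definition multiple_representatives :: "nat \<Rightarrow> int ^ 'm \<Rightarrow> (int ^ 'm) set" where
  "multiple_representatives p v = (\<Union>k\<in>{1..p - 1}. {w. perfect_representative p (int k *s v) w})"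

section \<open>Finiteness and scalar products of integral vectors\<close>

lemma finite_vec_entries:
  assumes "finite S"
  shows "finite {w :: 'a ^ 'm. \<forall>i. w $ i \<in> S}"
proof -
  have "finite (PiE (UNIV :: 'm set) (\<lambda>_. S))"
    using assms by (intro finite_PiE) auto
  then have "finite (vec_lambda ` PiE (UNIV :: 'm set) (\<lambda>_. S))"
    by simp
  moreover have "{w :: 'a ^ 'm. \<forall>i. w $ i \<in> S} \<subseteq> vec_lambda ` PiE UNIV (\<lambda>_. S)"
    by (auto intro!: image_eqI[where x = "vec_nth _"] simp: PiE_def)
  ultimately show ?thesis
    by (rule finite_subset[rotated])
qed

lemma scalar_product_self_nonneg: "scalar_product (w :: int ^ 'm) w \<ge> 0"
  by (simp add: scalar_product_def sum_nonneg)

lemma scalar_product_self_eq_0_iff: "scalar_product (w :: int ^ 'm) w = 0 \<longleftrightarrow> w = 0"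
  by (simp add: scalar_product_def sum_nonneg_eq_0_iff vec_eq_iff)

text \<open>The one expansion behind the orthogonality of representatives; it is applied to
  \<open>l w - k w'\<close>, \<open>w - w'\<close> and \<open>w + w'\<close>.\<close>

lemma scalar_product_combination_self:
  fixes w w' :: "int ^ 'm"
  shows "scalar_product (a *s w + b *s w') (a *s w + b *s w') =
    a\<^sup>2 * scalar_product w w + 2 * a * b * scalar_product w w' + b\<^sup>2 * scalar_product w' w'"
  by (simp add: scalar_product_def sum_distrib_left sum.distrib[symmetric] algebra_simps
      power2_eq_square)

lemma square_entry_le_scalar_product_self: "(w $ i)\<^sup>2 \<le> scalar_product (w :: int ^ 'm) w"
  unfolding scalar_product_def power2_eq_square
  by (rule member_le_sum) auto

text \<open>Squared length \<open>p^2\<close> confines every entry to the interval from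
  \<open>-p\<close> to \<open>p\<close>. Finiteness makes \<open>card\<close> additive over the
  disjoint sets of representatives.\<close>

lemma finite_perfect_representatives: "finite {w :: int ^ 'm. perfect_representative p v w}"
proof (rule finite_subset)
  show "{w. perfect_representative p v w} \<subseteq> {w. \<forall>i. w $ i \<in> {- int p..int p}}"
  proof clarify
    fix w :: "int ^ 'm" and i
    assume "perfect_representative p v w"
    then have "(w $ i)\<^sup>2 \<le> (int p)\<^sup>2"
      using square_entry_le_scalar_product_self[of w i] by (simp add: perfect_representative_def)
    then have "\<bar>w $ i\<bar> \<le> int p"
      by (metis abs_le_square_iff abs_of_nat)
    then show "w $ i \<in> {- int p..int p}"
      by auto
  qed
qed (rule finite_vec_entries, simp)

section \<open>Counting representatives of the multiples of \<open>v\<close>\<close>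

lemma not_dvd_of_range:
  assumes "k \<in> {1..p - 1}"
  shows "\<not> int p dvd int k"
proof -
  have "0 < k" "k < p"
    using assms by auto
  then show ?thesis
    by (simp add: nat_dvd_not_less)
qed

text \<open>Any entry of \<open>v\<close> is a unit mod \<open>p\<close>, so \<open>w\<close>
  determines the multiplier mod \<open>p\<close>, and the numbers from \<open>1\<close> to
  \<open>p - 1\<close> have distinct residues. This turns the sum in the theorem into the size of a
  union.\<close>

lemma perfect_representatives_disjoint:
  fixes v :: "int ^ 'm"
  assumes "prime p" and v: "\<And>i. \<not> [v $ i = 0] (mod int p)"
    and kl: "k \<in> {1..p - 1}" "l \<in> {1..p - 1}"
    and w: "perfect_representative p (int k *s v) w" "perfect_representative p (int l *s v) w"
  shows "k = l"
proof -
  fix i :: 'm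
  have "[int k * v $ i = int l * v $ i] (mod int p)"
    using w by (auto simp: perfect_representative_def vec_cong_def dest: cong_sym intro: cong_trans)
  moreover have "coprime (v $ i) (int p)"
    using \<open>prime p\<close> v[of i] by (simp add: cong_0_iff prime_imp_coprime coprime_commute)
  ultimately have "[int k = int l] (mod int p)"
    by (simp add: cong_mult_rcancel)
  then have "[k = l] (mod p)"
    by (simp add: cong_int_iff)
  then show ?thesis
    using kl by (intro cong_less_imp_eq_nat[of k p l]) auto
qed

lemma finite_multiple_representatives: "finite (multiple_representatives p v)"
  by (simp add: multiple_representatives_def finite_perfect_representatives)

lemma card_multiple_representatives:
  fixes v :: "int ^ 'm"
  assumes "prime p" "\<And>i. \<not> [v $ i = 0] (mod int p)"
  shows "(\<Sum>k = 1..p - 1. card {w. perfect_representative p (int k *s v) w}) =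
    card (multiple_representatives p v)"
  unfolding multiple_representatives_def
  using perfect_representatives_disjoint[OF assms]
  by (subst card_UN_disjoint) (auto simp: finite_perfect_representatives)

lemma multiple_representativesE:
  assumes "w \<in> multiple_representatives p v"
  obtains k where "k \<in> {1..p - 1}" "\<And>i. [w $ i = int k * v $ i] (mod int p)"
    "scalar_product w 1 = int p" "scalar_product w w = (int p)\<^sup>2"
  using assms by (auto simp: multiple_representatives_def perfect_representative_def vec_cong_def)

text \<open>Both \<open>k\<close> and the entry of \<open>v\<close> are units mod \<open>p\<close>.
  This later yields the exact level \<open>p\<close>, a rank of at least \<open>1\<close>, and
  \<open>w \<noteq> 0\<close>.\<close>

lemma multiple_representative_entry:
  fixes v :: "int ^ 'm"
  assumes "prime p" "\<And>i. \<not> [v $ i = 0] (mod int p)" "w \<in> multiple_representatives p v"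
  shows "\<not> int p dvd w $ i"
proof -
  obtain k where k: "k \<in> {1..p - 1}" "[w $ i = int k * v $ i] (mod int p)"
    using assms(3) by (elim multiple_representativesE) blast
  have "\<not> int p dvd int k * v $ i"
    using assms(1) assms(2)[of i] not_dvd_of_range[OF k(1)]
    by (simp add: prime_dvd_mult_iff cong_0_iff)
  then show ?thesis
    using k(2) cong_dvd_iff by blast
qed

section \<open>Orthogonality of distinct representatives\<close>

lemma multiple_representatives_orthogonal:
  fixes v :: "int ^ 'm"
  assumes "prime p" "odd p"
    and w: "w \<in> multiple_representatives p v" and w': "w' \<in> multiple_representatives p v"
    and "w \<noteq> w'"
  shows "scalar_product w w' = 0"
proof -
  obtain k where k: "k \<in> {1..p - 1}" "\<And>i. [w $ i = int k * v $ i] (mod int p)"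
    and w1: "scalar_product w 1 = int p" and ww: "scalar_product w w = (int p)\<^sup>2"
    using w by (elim multiple_representativesE) blast
  obtain l where l: "l \<in> {1..p - 1}" "\<And>i. [w' $ i = int l * v $ i] (mod int p)"
    and w1': "scalar_product w' 1 = int p" and ww': "scalar_product w' w' = (int p)\<^sup>2"
    using w' by (elim multiple_representativesE) blast
  define s where "s = scalar_product w w'"
  have p: "int p > 0"
    using \<open>prime p\<close> prime_gt_0_nat by simp
  have "\<exists>z. int l * w $ i - int k * w' $ i = int p * z" for i
  proof -
    have "[int l * w $ i = int l * (int k * v $ i)] (mod int p)"
      using k by (intro cong_mult) auto
    also have "int l * (int k * v $ i) = int k * (int l * v $ i)"
      by simp
    also have "[int k * (int l * v $ i) = int k * w' $ i] (mod int p)"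
      using l by (intro cong_mult cong_sym[OF l(2)]) auto
    finally show ?thesis
      by (simp add: cong_iff_dvd_diff dvd_def)
  qed
  then obtain z where z: "\<And>i. int l * w $ i - int k * w' $ i = int p * z i"
    by metis
  \<comment> \<open>The vanishing summand \<open>0 *s 0\<close> gives the right side the shape of a
    two-term combination, so the same expansion applies to both sides.\<close>
  have "int l *s w + (- int k) *s w' = int p *s (\<chi> i. z i) + 0 *s 0"
    using z by (simp add: vec_eq_iff)
  then have "(int l)\<^sup>2 * (int p)\<^sup>2 + 2 * int l * (- int k) * s + (- int k)\<^sup>2 * (int p)\<^sup>2
      = (int p)\<^sup>2 * scalar_product (\<chi> i. z i) (\<chi> i. z i)"
    using scalar_product_combination_self[of "int l" w "- int k" w']
      scalar_product_combination_self[of "int p" "\<chi> i. z i" 0 0]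
    by (simp add: ww ww' s_def)
  then have "(2 * int l * int k) * s =
      (int p)\<^sup>2 * ((int l)\<^sup>2 + (int k)\<^sup>2 - scalar_product (\<chi> i. z i) (\<chi> i. z i))"
    by (simp add: algebra_simps)
  then have "(int p)\<^sup>2 dvd (2 * int l * int k) * s"
    by simp
  moreover have "coprime ((int p)\<^sup>2) (2 * int l * int k)"
  proof -
    have "prime (int p)"
      using \<open>prime p\<close> by simp
    then have "coprime (int p) (int l)" "coprime (int p) (int k)"
      using not_dvd_of_range k l by (simp_all add: prime_imp_coprime)
    moreover have "coprime (int p) 2"
      using \<open>odd p\<close> by simp
    ultimately show ?thesis
      by simp
  qed
  ultimately have "(int p)\<^sup>2 dvd s"
    by (simp add: coprime_dvd_mult_right_iff)
  then obtain t where t: "s = (int p)\<^sup>2 * t" ..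
  \<comment> \<open>Positivity of the squared length of \<open>w - w'\<close> gives the strict bound
    \<open>s < p^2\<close>.\<close>
  have "w + (-1) *s w' \<noteq> 0"
    using \<open>w \<noteq> w'\<close> by (simp add: vec_eq_iff)
  moreover have "scalar_product (w + (-1) *s w') (w + (-1) *s w') = 2 * (int p)\<^sup>2 - 2 * s"
    using scalar_product_combination_self[of 1 w "-1" w'] by (simp add: ww ww' s_def)
  ultimately have "(int p)\<^sup>2 * t < (int p)\<^sup>2 * 1"
    using scalar_product_self_nonneg[of "w + (-1) *s w'"]
      scalar_product_self_eq_0_iff[of "w + (-1) *s w'"] t by simp
  then have "t < 1"
    using p by (simp add: mult_less_cancel_left)
  \<comment> \<open>The case \<open>w' = -w\<close> is excluded by the entry sums, both equal to
    \<open>p\<close>; hence \<open>s > -p^2\<close> is strict as well, and \<open>0\<close> is the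
    only multiple of \<open>p^2\<close> left.\<close>
  have "scalar_product (w + w') 1 = 2 * int p"
    using w1 w1' by (simp add: scalar_product_def sum.distrib)
  moreover have "scalar_product (0 :: int ^ 'm) 1 = 0"
    by (simp add: scalar_product_def)
  ultimately have "w + w' \<noteq> 0"
    using p by force
  moreover have "scalar_product (w + w') (w + w') = 2 * (int p)\<^sup>2 + 2 * s"
    using scalar_product_combination_self[of 1 w 1 w'] by (simp add: ww ww' s_def)
  ultimately have "(int p)\<^sup>2 * (-1) < (int p)\<^sup>2 * t"
    using scalar_product_self_nonneg[of "w + w'"]
      scalar_product_self_eq_0_iff[of "w + w'"] t by simp
  then have "-1 < t"
    using p by (subst (asm) mult_less_cancel_left_pos) auto
  then have "t = 0"
    using \<open>t < 1\<close> by simp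
  then show ?thesis
    using t s_def by simp
qed

section \<open>From \<open>m\<close> representatives to a primitive matrix\<close>

lemma generates_of_orthogonal_basis:
  fixes v :: "int ^ 'm" and f :: "'m \<Rightarrow> int ^ 'm"
  assumes "prime p" "odd p" and v: "\<And>i. \<not> [v $ i = 0] (mod int p)"
    and "inj f" and f: "\<And>j. f j \<in> multiple_representatives p v"
  shows "generates p v (\<chi> i j. of_int (f j $ i) / of_nat p)"
proof -
  define Q :: "rat ^ 'm ^ 'm" where "Q = (\<chi> i j. of_int (f j $ i) / of_nat p)"
  have p: "p > 0"
    using \<open>prime p\<close> prime_gt_0_nat by simp
  have f1: "(\<Sum>i\<in>UNIV. f j $ i) = int p" for j
    using f[of j] by (elim multiple_representativesE) (simp add: scalar_product_def)
  have ff: "(\<Sum>i\<in>UNIV. f a $ i * f b $ i) = (if a = b then (int p)\<^sup>2 else 0)" for a b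
  proof (cases "a = b")
    case True
    then show ?thesis
      using f[of a] by (elim multiple_representativesE) (simp add: scalar_product_def)
  next
    case False
    then have "f a \<noteq> f b"
      using \<open>inj f\<close> by (auto dest: injD)
    then show ?thesis
      using multiple_representatives_orthogonal[OF assms(1,2) f f] False
      by (simp add: scalar_product_def)
  qed
  have QtQ: "transpose Q ** Q = mat 1"
  proof -
    have "(\<Sum>i\<in>UNIV. Q $ i $ a * Q $ i $ b) = (if a = b then 1 else 0)" for a b
    proof -
      have "(\<Sum>i\<in>UNIV. Q $ i $ a * Q $ i $ b) =
          of_int (\<Sum>i\<in>UNIV. f a $ i * f b $ i) / (of_nat p)\<^sup>2"
        by (simp add: Q_def sum_divide_distrib power2_eq_square)
      then show ?thesis
        using p by (simp add: ff)
    qed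
    then show ?thesis
      by (simp add: matrix_matrix_mult_def transpose_def mat_def vec_eq_iff)
  qed
  then have QQt: "Q ** transpose Q = mat 1"
    using matrix_left_right_inverse by blast
  have "transpose Q *v 1 = 1"
  proof -
    have "(\<Sum>i\<in>UNIV. Q $ i $ j) = 1" for j
    proof -
      have "(\<Sum>i\<in>UNIV. Q $ i $ j) = of_int (\<Sum>i\<in>UNIV. f j $ i) / of_nat p"
        by (simp add: Q_def sum_divide_distrib)
      then show ?thesis
        using p by (simp add: f1)
    qed
    then show ?thesis
      by (simp add: matrix_vector_mult_def transpose_def vec_eq_iff)
  qed
  \<comment> \<open>The entry sums of the columns only say that the transpose fixes the all-one
    vector; applying \<open>Q\<close> carries this over to \<open>Q\<close> itself.\<close>
  then have "Q *v 1 = Q *v (transpose Q *v 1)"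
    by simp
  also have "\<dots> = 1"
    by (simp only: matrix_vector_mul_assoc QQt matrix_vector_mul_lid)
  finally have "regular_orthogonal Q"
    using QtQ QQt by (simp add: regular_orthogonal_def orthogonal_matrix_def)
  moreover have "level Q = p"
    unfolding level_def
  proof (rule Least_equality)
    show "0 < p \<and> integral_multiple p Q"
      using p by (simp add: integral_multiple_def Q_def)
  next
    fix k
    assume k: "0 < k \<and> integral_multiple k Q"
    \<comment> \<open>Any single entry suffices: \<open>p\<close> divides \<open>k\<close> times it
      but not the entry itself, so \<open>p\<close> divides \<open>k\<close>.\<close>
    fix i j :: 'm
    have "of_nat k * Q $ i $ j \<in> \<int>"
      using k by (simp add: integral_multiple_def)
    then obtain n where "of_nat k * Q $ i $ j = of_int n"
      by (auto elim: Ints_cases)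
    then have "of_int (int k * f j $ i) = (of_int (int p * n) :: rat)"
      using p by (simp add: Q_def field_simps)
    then have "int p dvd int k * f j $ i"
      by (simp only: of_int_eq_iff) simp
    then have "int p dvd int k"
      using multiple_representative_entry[OF assms(1) v f] \<open>prime p\<close>
      by (simp add: prime_dvd_mult_iff)
    then show "p \<le> k"
      using k by (simp add: dvd_imp_le)
  qed
  moreover have col: "column j (int_multiple p Q) = f j" for j
    using p by (simp add: column_def int_multiple_def Q_def vec_eq_iff)
  obtain c where c: "\<And>j. c j \<in> {1..p - 1}" "\<And>i j. [f j $ i = int (c j) * v $ i] (mod int p)"
  proof -
    have "\<exists>k. k \<in> {1..p - 1} \<and> (\<forall>i. [f j $ i = int k * v $ i] (mod int p))" for j
      using f[of j] by (elim multiple_representativesE) blast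
    then show ?thesis
      using that by metis
  qed
  have "rank_mod p (int_multiple p Q) = 1"
    unfolding rank_mod_def
  proof (rule Max_eqI)
    have "{card J |J. indep_columns_mod p (int_multiple p Q) J} \<subseteq> card ` (UNIV :: 'm set set)"
      by auto
    then show "finite {card J |J. indep_columns_mod p (int_multiple p Q) J}"
      by (rule finite_subset) simp
  next
    fix n
    assume "n \<in> {card J |J. indep_columns_mod p (int_multiple p Q) J}"
    then obtain J where n: "n = card J" and J: "indep_columns_mod p (int_multiple p Q) J"
      by auto
    have "a = b" if ab: "a \<in> J" "b \<in> J" for a b
    proof (rule ccontr)
      assume "a \<noteq> b"
      \<comment> \<open>As \<open>f a \<equiv> c a * v\<close> and
        \<open>f b \<equiv> c b * v\<close>, the coefficients \<open>c b\<close> and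
        \<open>- c a\<close> make the two columns cancel mod \<open>p\<close>, although
        \<open>c b\<close> is a unit.\<close>
      define d where "d j = (if j = a then int (c b) else if j = b then - int (c a) else 0)" for j
      have "(\<Sum>j\<in>J. d j *s column j (int_multiple p Q)) = (\<Sum>j\<in>{a, b}. d j *s f j)"
        unfolding col using ab by (intro sum.mono_neutral_right) (auto simp: d_def)
      also have "\<dots> = int (c b) *s f a + (- int (c a)) *s f b"
        using \<open>a \<noteq> b\<close> by (simp add: d_def)
      finally have sum: "(\<Sum>j\<in>J. d j *s column j (int_multiple p Q)) =
        int (c b) *s f a + (- int (c a)) *s f b" .
      have "[int (c b) * f a $ i + (- int (c a)) * f b $ i =
          int (c b) * (int (c a) * v $ i) + (- int (c a)) * (int (c b) * v $ i)] (mod int p)" for i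
        by (intro cong_add cong_mult c cong_refl)
      then have "vec_cong (\<Sum>j\<in>J. d j *s column j (int_multiple p Q)) 0 p"
        unfolding sum vec_cong_def by (simp add: mult.left_commute)
      then have "[d a = 0] (mod int p)"
        using J ab by (simp add: indep_columns_mod_def)
      then show False
        using not_dvd_of_range[OF c(1)[of b]] by (simp add: d_def cong_0_iff)
    qed
    then show "n \<le> 1"
      unfolding n by (auto simp: card_le_Suc0_iff_eq)
  next
    fix j :: 'm
    have "indep_columns_mod p (int_multiple p Q) {j}"
      using multiple_representative_entry[OF assms(1) v f] \<open>prime p\<close>
      by (auto simp: indep_columns_mod_def col vec_cong_def cong_0_iff prime_dvd_mult_iff)
    then show "1 \<in> {card J |J. indep_columns_mod p (int_multiple p Q) J}"
      by (intro CollectI exI[of _ "{j}"]) simp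
  qed
  moreover have "\<exists>c. vec_cong (column j (int_multiple p Q)) (c *s v) p" for j
    using c(2) by (auto simp: col vec_cong_def)
  ultimately have "generates p v Q"
    by (simp add: generates_def primitive_matrix_def)
  then show ?thesis
    by (simp add: Q_def)
qed

section \<open>From a generated matrix back to representatives\<close>

text \<open>The product of all denominators works. Without such a witness the \<open>LEAST\<close>
  in \<open>level\<close> would not yield that \<open>pQ\<close> is integral.\<close>

lemma ex_integral_multiple: "\<exists>k. 0 < k \<and> integral_multiple k (Q :: rat ^ 'm ^ 'n)"
proof (intro exI conjI)
  define d where "d = (\<Prod>(i, j)\<in>UNIV. nat (snd (quotient_of (Q $ i $ j))))"
  show "0 < d"
    unfolding d_def using quotient_of_denom_pos' by (intro prod_pos) auto
  show "integral_multiple d Q"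
    unfolding integral_multiple_def
  proof (intro allI)
    fix i j
    define a b where "a = fst (quotient_of (Q $ i $ j))" and "b = snd (quotient_of (Q $ i $ j))"
    have b: "b > 0"
      by (simp add: b_def quotient_of_denom_pos')
    have "nat b dvd d"
      unfolding d_def b_def
      using dvd_prodI[of UNIV "(i, j)" "\<lambda>(i, j). nat (snd (quotient_of (Q $ i $ j)))"]
      by simp
    then obtain e where e: "d = nat b * e" ..
    have "Q $ i $ j = of_int a / of_int b"
      unfolding a_def b_def by (rule quotient_of_div) simp
    then have "of_nat d * Q $ i $ j = of_int (int e * a)"
      using b by (simp add: e field_simps)
    then show "of_nat d * Q $ i $ j \<in> \<int>"
      by (metis Ints_of_int)
  qed
qed

text \<open>Gives more than the count: the columns of \<open>pQ\<close> are exactly the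
  representatives, each occurring once.\<close>

lemma generates_columns:
  fixes v :: "int ^ 'm" and Q :: "rat ^ 'm ^ 'm"
  assumes "prime p" "odd p" and v: "\<And>i. \<not> [v $ i = 0] (mod int p)" and Q: "generates p v Q"
  shows "bij_betw (\<lambda>j. column j (int_multiple p Q)) UNIV (multiple_representatives p v)"
proof -
  define f where "f j = column j (int_multiple p Q)" for j
  have p: "p > 0"
    using \<open>prime p\<close> prime_gt_0_nat by simp
  have prim: "primitive_matrix p Q" and gen: "\<And>j. \<exists>c. vec_cong (f j) (c *s v) p"
    using Q by (auto simp: generates_def f_def)
  have QtQ: "transpose Q ** Q = mat 1" and QQt: "Q ** transpose Q = mat 1" and Q1: "Q *v 1 = 1"
    and lev: "level Q = p"
    using prim by (auto simp: primitive_matrix_def regular_orthogonal_def orthogonal_matrix_def)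
  have level_le: "p \<le> k" if "0 < k" "integral_multiple k Q" for k
    using that lev Least_le[of "\<lambda>k. 0 < k \<and> integral_multiple k Q" k] by (simp add: level_def)
  have "integral_multiple p Q"
    using lev LeastI_ex[OF ex_integral_multiple[of Q]] by (simp add: level_def)
  then have fQ: "of_int (f j $ i) = of_nat p * Q $ i $ j" for i j
    by (simp add: f_def column_def of_int_int_multiple)
  have "transpose Q *v 1 = transpose Q *v (Q *v 1)"
    by (simp add: Q1)
  also have "\<dots> = 1"
    by (simp only: matrix_vector_mul_assoc QtQ matrix_vector_mul_lid)
  finally have "(\<Sum>i\<in>UNIV. Q $ i $ j) = 1" for j
    by (simp add: matrix_vector_mult_def transpose_def vec_eq_iff)
  then have "(of_int (scalar_product (f j) 1) :: rat) = of_int (int p)" for j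
    by (simp add: scalar_product_def fQ flip: sum_distrib_left)
  then have f1: "scalar_product (f j) 1 = int p" for j
    by (simp only: of_int_eq_iff)
  have orth: "(\<Sum>i\<in>UNIV. Q $ i $ a * Q $ i $ b) = (if a = b then 1 else 0)" for a b
    using QtQ by (simp add: matrix_matrix_mult_def transpose_def mat_def vec_eq_iff)
  have "(of_int (scalar_product (f a) (f b)) :: rat) = of_int (if a = b then (int p)\<^sup>2 else 0)"
    for a b
  proof -
    have "(of_int (scalar_product (f a) (f b)) :: rat) =
        (of_nat p)\<^sup>2 * (\<Sum>i\<in>UNIV. Q $ i $ a * Q $ i $ b)"
      by (simp add: scalar_product_def fQ sum_distrib_left power2_eq_square mult_ac)
    then show ?thesis
      by (simp add: orth)
  qed
  then have ff: "scalar_product (f a) (f b) = (if a = b then (int p)\<^sup>2 else 0)" for a b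
    by (simp only: of_int_eq_iff)
  \<comment> \<open>The row lengths, obtained from \<open>Q ** transpose Q = mat 1\<close>, are what
    rules out a column vanishing mod \<open>p\<close>.\<close>
  have rows: "(\<Sum>j\<in>UNIV. f j $ i * f j $ i) = (int p)\<^sup>2" for i
  proof -
    have "(\<Sum>j\<in>UNIV. Q $ i $ j * Q $ i $ j) = 1"
      using QQt by (simp add: matrix_matrix_mult_def transpose_def mat_def vec_eq_iff)
    then have "(of_int (\<Sum>j\<in>UNIV. f j $ i * f j $ i) :: rat) = of_int ((int p)\<^sup>2)"
      using sum_distrib_left[of "(of_nat p :: rat)\<^sup>2" "\<lambda>j. Q $ i $ j * Q $ i $ j" UNIV]
      by (simp add: fQ power2_eq_square mult_ac)
    then show ?thesis
      by (simp only: of_int_eq_iff)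
  qed
  obtain c where c: "\<And>i j. [f j $ i = c j * v $ i] (mod int p)"
    using gen unfolding vec_cong_def by (metis vector_smult_component)
  \<comment> \<open>Since the entries of \<open>v\<close> are units, a column vanishes mod
    \<open>p\<close> either in all entries or in none.\<close>
  have f_dvd: "int p dvd f j $ i \<longleftrightarrow> int p dvd c j" for i j
  proof -
    have "int p dvd f j $ i \<longleftrightarrow> int p dvd c j * v $ i"
      using c cong_dvd_iff by blast
    then show ?thesis
      using \<open>prime p\<close> v[of i] by (simp add: prime_dvd_mult_iff cong_0_iff)
  qed
  \<comment> \<open>If every column vanished mod \<open>p\<close>, then \<open>Q\<close> would be
    integral and its level would be \<open>1\<close>.\<close>
  obtain j0 where j0: "\<not> int p dvd c j0"
  proof -
    have False if all: "\<And>j. int p dvd c j"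
    proof -
      have "integral_multiple 1 Q"
        unfolding integral_multiple_def
      proof (intro allI)
        fix i j
        obtain n where "f j $ i = int p * n"
          using all f_dvd by blast
        then have "Q $ i $ j = of_int n"
          using fQ[of j i] p by simp
        then show "of_nat 1 * Q $ i $ j \<in> \<int>"
          by simp
      qed
      then have "p \<le> 1"
        using level_le by simp
      then show False
        using prime_gt_1_nat[OF \<open>prime p\<close>] by simp
    qed
    then show ?thesis
      using that by blast
  qed
  \<comment> \<open>A nonzero entry divisible by \<open>p\<close> already uses up the squared length
    \<open>p^2\<close> of its row, leaving no room for the nonzero entry of column \<open>j0\<close>
    in that row.\<close>
  have c_ndvd: "\<not> int p dvd c j" for j
  proof
    assume dvd: "int p dvd c j"
    obtain i where i: "f j $ i \<noteq> 0"
    proof -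
      have "f j \<noteq> 0"
        using f1[of j] p by (auto simp: scalar_product_def)
      then show ?thesis
        using that by (auto simp: vec_eq_iff)
    qed
    have "int p dvd f j $ i"
      using dvd f_dvd by blast
    then have "int p \<le> \<bar>f j $ i\<bar>"
      using dvd_imp_le_int[OF i, of "int p"] by simp
    then have "(int p)\<^sup>2 \<le> (f j $ i)\<^sup>2"
      using abs_le_square_iff[of "int p" "f j $ i"] by simp
    moreover have "f j0 $ i \<noteq> 0"
      using j0 f_dvd[of j0 i] by auto
    then have "(f j0 $ i)\<^sup>2 > 0"
      by simp
    moreover have "j \<noteq> j0"
      using dvd j0 by auto
    then have "(f j $ i)\<^sup>2 + (f j0 $ i)\<^sup>2 \<le> (\<Sum>j\<in>UNIV. f j $ i * f j $ i)"
      using sum_mono2[of UNIV "{j, j0}" "\<lambda>j. f j $ i * f j $ i"] by (simp add: power2_eq_square)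
    ultimately show False
      using rows[of i] by simp
  qed
  have f_rep: "f j \<in> multiple_representatives p v" for j
  proof -
    \<comment> \<open>The coefficient \<open>c j\<close> is an arbitrary integer; its residue is
      nonzero and so lies in the required range.\<close>
    define k where "k = nat (c j mod int p)"
    have "c j mod int p \<noteq> 0" "0 \<le> c j mod int p" "c j mod int p < int p"
      using c_ndvd[of j] p by (auto simp: dvd_eq_mod_eq_0)
    then have k: "k \<in> {1..p - 1}" "int k = c j mod int p"
      unfolding k_def by auto
    have "[f j $ i = int k * v $ i] (mod int p)" for i
      using c[of j i] by (simp add: k(2) cong_def mod_mult_left_eq)
    then have "perfect_representative p (int k *s v) (f j)"
      by (simp add: perfect_representative_def vec_cong_def f1 ff)
    then show ?thesis
      using k(1) by (auto simp: multiple_representatives_def)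
  qed
  have "inj f"
  proof (rule injI)
    fix a b
    assume "f a = f b"
    then have "scalar_product (f a) (f b) = (int p)\<^sup>2"
      using ff[of b b] by simp
    then show "a = b"
      using ff[of a b] p by (auto split: if_splits)
  qed
  moreover have "w \<in> range f" if w: "w \<in> multiple_representatives p v" for w
  proof (rule ccontr)
    assume "w \<notin> range f"
    then have "scalar_product (f j) w = 0" for j
      using multiple_representatives_orthogonal[OF assms(1,2) f_rep w] by (metis rangeI)
    \<comment> \<open>Over the rationals \<open>w\<close> is orthogonal to every column of the
      invertible matrix \<open>Q\<close>, hence zero, contradicting its nonzero entries mod
      \<open>p\<close>.\<close>
    define x :: "rat ^ 'm" where "x = (\<chi> i. of_int (w $ i))"
    have "(\<Sum>i\<in>UNIV. Q $ i $ j * x $ i) = 0" for j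
    proof -
      have "of_nat p * (\<Sum>i\<in>UNIV. Q $ i $ j * x $ i) = of_int (scalar_product (f j) w)"
        by (simp add: scalar_product_def fQ sum_distrib_left x_def mult_ac)
      then show ?thesis
        using p \<open>scalar_product (f j) w = 0\<close> by simp
    qed
    then have "transpose Q *v x = 0"
      by (simp add: matrix_vector_mult_def transpose_def vec_eq_iff)
    then have "Q *v (transpose Q *v x) = 0"
      by simp
    then have "x = 0"
      by (simp only: matrix_vector_mul_assoc QQt matrix_vector_mul_lid)
    then have "w = 0"
      by (simp add: x_def vec_eq_iff)
    then show False
      using multiple_representative_entry[OF assms(1) v w] by simp
  qed
  ultimately show ?thesis
    using f_rep by (auto simp: bij_betw_def simp flip: f_def)
qed

theorem theorem3p4:
  fixes p :: nat and v :: "int ^ 'm"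
  assumes "prime p" and "odd p"
    and "\<And>i. \<not> [v $ i = 0] (mod int p)"
  shows "(\<exists>Q :: rat ^ 'm ^ 'm. generates p v Q) \<longleftrightarrow>
    (\<Sum>k = 1..p - 1. card {w. perfect_representative p (int k *s v) w}) = CARD('m)"
proof -
  have "(\<exists>Q :: rat ^ 'm ^ 'm. generates p v Q) \<longleftrightarrow> card (multiple_representatives p v) = CARD('m)"
  proof
    assume "\<exists>Q :: rat ^ 'm ^ 'm. generates p v Q"
    then show "card (multiple_representatives p v) = CARD('m)"
      using generates_columns[OF assms] bij_betw_same_card by metis
  next
    assume "card (multiple_representatives p v) = CARD('m)"
    \<comment> \<open>Equal cardinality lets the type \<open>'m\<close> itself index the
      representatives, as it must index the columns.\<close>
    then obtain f :: "'m \<Rightarrow> int ^ 'm" where "bij_betw f UNIV (multiple_representatives p v)"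
      using finite_same_card_bij[OF finite finite_multiple_representatives] by metis
    then have "inj f" "\<And>j. f j \<in> multiple_representatives p v"
      by (auto simp: bij_betw_def)
    then show "\<exists>Q :: rat ^ 'm ^ 'm. generates p v Q"
      using generates_of_orthogonal_basis[OF assms] by blast
  qed
  then show ?thesis
    using card_multiple_representatives[OF assms(1,3)] by simp
qed

end
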